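(* Let $A,B,C$ be finite sets, $\theta=\{1,\dots,T\}$, $\mathcal{S}=\{1,\dots,S\}$, and let $W_t:A\to\mathcal{P}(B)$, $t\in\theta$, and $V_s:A\to\mathcal{P}(C)$, $s\in\mathcal{S}$, be channels. For $t\in\theta$ put $\mathfrak{W}_t=\{(W_t,V_s):s\in\mathcal{S}\}$, and let $\mathfrak{W}=\bigcup_{t\in\theta}\mathfrak{W}_t$. The secrecy capacity of the compound wiretap channel $\mathfrak{W}$ in the case where only the channel state $t$ to the legitimate receiver is known at the transmitter is $$C_{S,CSI_t}(\mathfrak{W})=\inf_{t\in\theta}C_S(\mathfrak{W}_t),$$ where $C_S(\mathfrak{W}_t)$ is the secrecy capacity of the compound wiretap channel $\mathfrak{W}_t$ without channel state information.
   Context: $\mathcal{P}(B)$ is the set of probability distributions on the finite set $B$; a channel $W:A\to\mathcal{P}(B)$ is a stochastic matrix; $W^{\otimes n}$ is its $n$-th memoryless extension. Logarithms are to base 2. $W_t$ is the channel to the legitimate receiver, $V_s$ the channel to the eavesdropper. Code with $CSI_t$ for $\mathfrak{W}$ (the transmitter knows $t$ but not $s$; the legitimate receiver knows neither): an $(n,J_n)$ code consists of stochastic encoders $E_t:\mathcal{J}_n\to\mathcal{P}(A^n)$, $t\in\theta$, with $\mathcal{J}_n=\{1,\dots,J_n\}$, and mutually disjoint decoding sets $\{D_j\subset B^n:j\in\mathcal{J}_n\}$ not depending on $t$ or $s$. A number $R\ge0$ is an achievable secrecy rate with $CSI_t$ if there is a sequence of such codes with $$\lim_{n\to\infty}\max_{t\in\theta}\max_{j\in\mathcal{J}_n}\sum_{x^n\in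 A^n}E_t(x^n|j)W_t^{\otimes n}(D_j^c|x^n)=0,\quad \liminf_{n\to\infty}\tfrac1n\log J_n\ge R,\quad \lim_{n\to\infty}\max_{(t,s)\in\theta\times\mathcal{S}}I(J;Z_{t,s}^n)=0,$$ where $J$ is uniform on $\mathcal{J}_n$ and $\Pr(J=j,Z_{t,s}^n=z^n)=\frac1{J_n}\sum_{x^n}E_t(x^n|j)V_s^{\otimes n}(z^n|x^n)$. $C_{S,CSI_t}(\mathfrak{W})$ is the largest (supremum) such $R$. $C_S(\mathfrak{W}_t)$ for fixed $t$: the largest (supremum) $R\ge 0$ for which there is a sequence of codes, each consisting of one stochastic encoder $E:\mathcal{J}_n\to\mathcal{P}(A^n)$ and mutually disjoint decoding sets $D_j\subset B^n$, with $\max_{j}\sum_{x^n}E(x^n|j)W_t^{\otimes n}(D_j^c|x^n)\to0$, $\liminf_n\frac1n\log J_n\ge R$, and $\max_{s\in\mathcal{S}}I(J;Z_s^n)\to0$, where $J$ is uniform on $\mathcal{J}_n$ and $\Pr(J=j,Z_s^n=z^n)=\frac1{J_n}\sum_{x^n}E(x^n|j)V_s^{\otimes n}(z^n|x^n)$. *)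

theory Defs
  imports "HOL-Probability.Probability"
begin

text \<open>
  Finite alphabets are types of class \<open>finite\<close>, and a channel from \<open>'a\<close> to \<open>'b\<close> is a
  function \<open>'a \<Rightarrow> 'b pmf\<close>. A word of length \<open>n\<close> is a function on \<open>{..<n}\<close>, extended by
  \<open>undefined\<close>, so that words of length \<open>n\<close> form a finite set.
\<close>

definition words :: "nat \<Rightarrow> (nat \<Rightarrow> 'a) set" where
  "words n = {..<n} \<rightarrow>\<^sub>E UNIV"

definition memoryless :: "('a \<Rightarrow> 'b pmf) \<Rightarrow> nat \<Rightarrow> (nat \<Rightarrow> 'a) \<Rightarrow> (nat \<Rightarrow> 'b) pmf" where
  "memoryless W n x = Pi_pmf {..<n} undefined (\<lambda>i. W (x i))"

definition encoder :: "nat \<Rightarrow> nat \<Rightarrow> (nat \<Rightarrow> (nat \<Rightarrow> 'a) pmf) \<Rightarrow> bool" where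
  "encoder n J E \<longleftrightarrow> (\<forall>j\<in>{1..J}. set_pmf (E j) \<subseteq> words n)"

definition decoding_sets :: "nat \<Rightarrow> nat \<Rightarrow> (nat \<Rightarrow> (nat \<Rightarrow> 'b) set) \<Rightarrow> bool" where
  "decoding_sets n J D \<longleftrightarrow> (\<forall>j\<in>{1..J}. D j \<subseteq> words n) \<and> disjoint_family_on D {1..J}"

definition error_prob ::
  "nat \<Rightarrow> ('a \<Rightarrow> 'b pmf) \<Rightarrow> (nat \<Rightarrow> (nat \<Rightarrow> 'a) pmf) \<Rightarrow> (nat \<Rightarrow> (nat \<Rightarrow> 'b) set) \<Rightarrow> nat \<Rightarrow> real" where
  "error_prob n W E D j =
     (\<Sum>x\<in>words n. pmf (E j) x * measure_pmf.prob (memoryless W n x) (words n - D j))"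

text \<open>
  The joint law of the message and the eavesdropper's observation is carried by the finite
  set \<open>{1..J} \<times> words n\<close>, on which \<open>fst\<close> and \<open>snd\<close> are simple functions.
\<close>

definition message_output ::
  "nat \<Rightarrow> nat \<Rightarrow> ('a \<Rightarrow> 'c pmf) \<Rightarrow> (nat \<Rightarrow> (nat \<Rightarrow> 'a) pmf) \<Rightarrow> (nat \<times> (nat \<Rightarrow> 'c)) measure" where
  "message_output n J V E = point_measure ({1..J} \<times> words n)
     (\<lambda>(j, z). ennreal (1 / real J * (\<Sum>x\<in>words n. pmf (E j) x * pmf (memoryless V n x) z)))"

definition leakage ::
  "nat \<Rightarrow> nat \<Rightarrow> ('a \<Rightarrow> 'c pmf) \<Rightarrow> (nat \<Rightarrow> (nat \<Rightarrow> 'a) pmf) \<Rightarrow> real" where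
  "leakage n J V E = prob_space.mutual_information (message_output n J V E) 2
     (count_space {1..J}) (count_space (words n)) fst snd"

lemma finite_words [simp]: "finite (words n :: (nat \<Rightarrow> 'a::finite) set)"
  by (simp add: words_def finite_PiE)

lemma set_pmf_memoryless: "set_pmf (memoryless W n x) \<subseteq> words n"
  by (auto simp: memoryless_def words_def set_Pi_pmf PiE_dflt_def PiE_def extensional_def)

lemma pmf_memoryless:
  "z \<in> words n \<Longrightarrow> pmf (memoryless W n x) z = (\<Prod>i<n. pmf (W (x i)) (z i))"
  by (auto simp: memoryless_def words_def pmf_Pi PiE_def extensional_def)

lemma prob_space_message_output:
  fixes V :: "'a::finite \<Rightarrow> 'c::finite pmf"
  assumes "J \<ge> 1" "encoder n J E"
  shows "prob_space (message_output n J V E)"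
proof (rule prob_spaceI)
  let ?q = "\<lambda>j z. \<Sum>x\<in>words n. pmf (E j) x * pmf (memoryless V n x) z"
  have "(\<Sum>z\<in>words n. ?q j z) = 1" if "j \<in> {1..J}" for j
  proof -
    have "(\<Sum>z\<in>words n. ?q j z)
        = (\<Sum>x\<in>words n. pmf (E j) x * (\<Sum>z\<in>words n. pmf (memoryless V n x) z))"
      by (subst sum.swap) (simp add: sum_distrib_left)
    also have "\<dots> = (\<Sum>x\<in>words n. pmf (E j) x)"
      by (simp add: sum_pmf_eq_1 set_pmf_memoryless)
    also have "\<dots> = 1"
      using assms that by (intro sum_pmf_eq_1) (auto simp: encoder_def)
    finally show ?thesis .
  qed
  then have "(\<Sum>(j, z)\<in>{1..J} \<times> words n. 1 / real J * ?q j z) = 1"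
    using assms(1) by (simp add: sum_divide_distrib[symmetric] flip: sum.cartesian_product)
  moreover have "0 \<le> 1 / real J * ?q j z" for j z
    by (intro mult_nonneg_nonneg sum_nonneg) auto
  ultimately show "emeasure (message_output n J V E) (space (message_output n J V E)) = 1"
    by (simp add: message_output_def space_point_measure emeasure_point_measure_finite
        case_prod_beta sum_ennreal)
qed

lemma leakage_eq:
  fixes V :: "'a::finite \<Rightarrow> 'c::finite pmf"
  assumes J: "J \<ge> 1" and E: "encoder n J E"
  defines "p \<equiv> \<lambda>j z. 1 / real J * (\<Sum>x\<in>words n. pmf (E j) x * pmf (memoryless V n x) z)"
  shows "leakage n J V E = (\<Sum>(j,z)\<in>{1..J}\<times>words n.
    p j z * log 2 (p j z / ((\<Sum>z\<in>words n. p j z) * (\<Sum>j\<in>{1..J}. p j z))))"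
proof -
  let ?M = "message_output n J V E"
  interpret prob_space ?M by (rule prob_space_message_output) fact+
  interpret information_space ?M 2 by standard simp
  have w: "words n \<noteq> ({}::(nat\<Rightarrow>'c) set)" by (auto simp: words_def PiE_eq_empty_iff)
  have sp: "space ?M = {1..J}\<times>words n" by (simp add: message_output_def space_point_measure)
  have pn: "p j z \<ge> 0" for j z unfolding p_def by (intro mult_nonneg_nonneg sum_nonneg) auto
  have em: "measure ?M A = (\<Sum>(j,z)\<in>A. p j z)" if "A \<subseteq> {1..J}\<times>words n" for A
  proof -
    have "?M = point_measure ({1..J}\<times>words n) (\<lambda>x. ennreal (p (fst x) (snd x)))"
      unfolding message_output_def p_def case_prod_beta ..
    hence "emeasure ?M A = ennreal (\<Sum>(j,z)\<in>A. p j z)"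
      using that pn by (simp add: emeasure_point_measure_finite case_prod_beta)
    thus ?thesis using pn by (simp add: measure_def sum_nonneg case_prod_beta)
  qed
  have f: "finite (space ?M)" by (simp add: sp)
  have st: "sets ?M = Pow (space ?M)" by (simp add: message_output_def sets_point_measure space_point_measure)
  have im: "fst ` space ?M = {1..J}" "snd ` space ?M = words n" using w J by (auto simp: sp)
  have sf: "simple_function ?M g" for g :: "_ \<Rightarrow> 'd" unfolding simple_function_def using f st by auto
  have X: "simple_distributed ?M fst (\<lambda>j. \<Sum>z\<in>words n. p j z)"
  proof (rule simple_distributedI[OF sf])
    fix j assume "j \<in> fst ` space ?M"
    hence j: "j \<in> {1..J}" using im by auto
    hence *: "fst -` {j} \<inter> space ?M = {j} \<times> words n" by (auto simp: sp)
    show "(\<Sum>z\<in>words n. p j z) = measure ?M (fst -` {j} \<inter> space ?M)"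
      unfolding * by (subst em) (use j in \<open>auto simp flip: sum.cartesian_product\<close>)
  qed (auto intro: sum_nonneg pn)
  have Y: "simple_distributed ?M snd (\<lambda>z. \<Sum>j\<in>{1..J}. p j z)"
  proof (rule simple_distributedI[OF sf])
    fix z assume "z \<in> snd ` space ?M"
    hence j: "z \<in> words n" using im by auto
    hence *: "snd -` {z} \<inter> space ?M = {1..J} \<times> {z}" by (auto simp: sp)
    show "(\<Sum>j\<in>{1..J}. p j z) = measure ?M (snd -` {z} \<inter> space ?M)"
      unfolding * by (subst em) (use j in \<open>auto simp flip: sum.cartesian_product\<close>)
  qed (auto intro: sum_nonneg pn)
  have XY: "simple_distributed ?M (\<lambda>x. (fst x, snd x)) (\<lambda>(j,z). p j z)"
  proof (rule simple_distributedI[OF sf])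
    fix y assume "y \<in> (\<lambda>x. (fst x, snd x)) ` space ?M"
    hence j: "y \<in> {1..J}\<times>words n" using sp by auto
    hence *: "(\<lambda>x. (fst x, snd x)) -` {y} \<inter> space ?M = {y}" by (auto simp: sp)
    show "(case y of (j,z) \<Rightarrow> p j z) = measure ?M ((\<lambda>x. (fst x, snd x)) -` {y} \<inter> space ?M)"
      unfolding * by (subst em) (use j in auto)
  qed (auto intro: pn)
  show ?thesis unfolding leakage_def
    using mutual_information_simple_distributed[OF X Y XY] unfolding im by (simp add: sp)
qed

definition achievable_CSIt ::
  "nat \<Rightarrow> nat \<Rightarrow> (nat \<Rightarrow> 'a::finite \<Rightarrow> 'b::finite pmf) \<Rightarrow> (nat \<Rightarrow> 'a \<Rightarrow> 'c::finite pmf) \<Rightarrow> real \<Rightarrow> bool"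
where
  "achievable_CSIt T S W V R \<longleftrightarrow> 0 \<le> R \<and>
     (\<exists>J E D.
        (\<forall>n\<ge>1. 1 \<le> J n \<and> (\<forall>t\<in>{1..T}. encoder n (J n) (E n t)) \<and> decoding_sets n (J n) (D n)) \<and>
        (\<lambda>n. MAX t\<in>{1..T}. MAX j\<in>{1..J n}. error_prob n (W t) (E n t) (D n) j) \<longlonglongrightarrow> 0 \<and>
        ereal R \<le> liminf (\<lambda>n. ereal (1 / real n * log 2 (real (J n)))) \<and>
        (\<lambda>n. MAX (t, s)\<in>{1..T} \<times> {1..S}. leakage n (J n) (V s) (E n t)) \<longlonglongrightarrow> 0)"

definition achievable ::
  "nat \<Rightarrow> ('a::finite \<Rightarrow> 'b::finite pmf) \<Rightarrow> (nat \<Rightarrow> 'a \<Rightarrow> 'c::finite pmf) \<Rightarrow> real \<Rightarrow> bool"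
where
  "achievable S W V R \<longleftrightarrow> 0 \<le> R \<and>
     (\<exists>J E D.
        (\<forall>n\<ge>1. 1 \<le> J n \<and> encoder n (J n) (E n) \<and> decoding_sets n (J n) (D n)) \<and>
        (\<lambda>n. MAX j\<in>{1..J n}. error_prob n W (E n) (D n) j) \<longlonglongrightarrow> 0 \<and>
        ereal R \<le> liminf (\<lambda>n. ereal (1 / real n * log 2 (real (J n)))) \<and>
        (\<lambda>n. MAX s\<in>{1..S}. leakage n (J n) (V s) (E n)) \<longlonglongrightarrow> 0)"

text \<open>
  The suprema are taken in \<open>ereal\<close>, where they are meaningful without a prior proof that the
  sets of achievable rates are nonempty and bounded.
\<close>

definition secrecy_capacity_CSIt ::
  "nat \<Rightarrow> nat \<Rightarrow> (nat \<Rightarrow> 'a::finite \<Rightarrow> 'b::finite pmf) \<Rightarrow> (nat \<Rightarrow> 'a \<Rightarrow> 'c::finite pmf) \<Rightarrow> ereal"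
where
  "secrecy_capacity_CSIt T S W V = (SUP R\<in>{R. achievable_CSIt T S W V R}. ereal R)"

definition secrecy_capacity ::
  "nat \<Rightarrow> ('a::finite \<Rightarrow> 'b::finite pmf) \<Rightarrow> (nat \<Rightarrow> 'a \<Rightarrow> 'c::finite pmf) \<Rightarrow> ereal"
where
  "secrecy_capacity S W V = (SUP R\<in>{R. achievable S W V R}. ereal R)"

end

theory Submission
  imports Defs "HOL-Real_Asymp.Real_Asymp"
begin

text \<open>
  No coding theorem is needed: codes for the individual states \<open>t\<close> are turned into one code with state
  information at the transmitter. If all the capacities on the right are positive, no \<open>W t\<close> is
  constant, and the transmitter can announce \<open>t\<close> to the receiver by a deterministic prefix of
  length \<open>O(sqrt n)\<close>, after which both use the given code for \<open>t\<close>. For fixed \<open>t\<close> the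
  eavesdropper's view of the prefix is independent of the message, so nothing is leaked by it. To
  make the number of messages independent of \<open>t\<close>, each code is restricted to its least leaking
  messages. The converse holds because a code with state information contains a code for each \<open>t\<close>.
\<close>

section \<open>Relative entropy and leakage\<close>

text \<open>
  Intended for \<open>p\<close> of finite support, contained in the support of \<open>r\<close>; otherwise junk
  values of infinite sums, division and logarithm enter.
\<close>

definition rel_entropy :: "'z pmf \<Rightarrow> 'z pmf \<Rightarrow> real" where
  "rel_entropy p r = (\<Sum>z\<in>set_pmf p. pmf p z * log 2 (pmf p z / pmf r z))"

text \<open>When \<open>q j\<close> is the output law given message \<open>j\<close>, this is the
  output law under a uniformly drawn message.\<close>

definition mixture :: "nat \<Rightarrow> (nat \<Rightarrow> 'z pmf) \<Rightarrow> 'z pmf" where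
  "mixture J q = bind_pmf (pmf_of_set {1..J}) q"

definition channel_output ::
  "('a \<Rightarrow> 'b pmf) \<Rightarrow> nat \<Rightarrow> (nat \<Rightarrow> 'a) pmf \<Rightarrow> (nat \<Rightarrow> 'b) pmf" where
  "channel_output W n e = bind_pmf e (memoryless W n)"

text \<open>The length of \<open>v\<close> is not a parameter: a word \<open>v\<close> is
  \<open>undefined\<close> past its end, and the shift carries this over to the
  concatenation.\<close>

definition append_word :: "nat \<Rightarrow> (nat \<Rightarrow> 'a) \<Rightarrow> (nat \<Rightarrow> 'a) \<Rightarrow> nat \<Rightarrow> 'a" where
  "append_word k u v = (\<lambda>i. if i < k then u i else v (i - k))"

lemma rel_entropy_superset:
  assumes "finite A" "set_pmf p \<subseteq> A"
  shows "rel_entropy p r = (\<Sum>z\<in>A. pmf p z * log 2 (pmf p z / pmf r z))"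
  unfolding rel_entropy_def using assms
  by (intro sum.mono_neutral_left) (auto simp: set_pmf_iff)

text \<open>Gibbs' inequality, from \<open>ln x \<le> x - 1\<close> applied to each ratio of masses;
  the mass that \<open>r\<close> puts on the support of \<open>p\<close> is at most one.\<close>

lemma rel_entropy_nonneg:
  assumes fin: "finite (set_pmf p)" and ac: "set_pmf p \<subseteq> set_pmf r"
  shows "0 \<le> rel_entropy p r"
proof -
  let ?A = "set_pmf p"
  have "(\<Sum>z\<in>?A. pmf p z - pmf r z) \<le> (\<Sum>z\<in>?A. pmf p z * ln (pmf p z / pmf r z))"
  proof (rule sum_mono)
    fix z assume "z \<in> ?A"
    then have p: "pmf p z > 0" and r: "pmf r z > 0"
      using ac by (auto simp: pmf_positive)
    then have "ln (pmf r z / pmf p z) \<le> pmf r z / pmf p z - 1"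
      by (intro ln_le_minus_one) auto
    then have "pmf p z * ln (pmf r z / pmf p z) \<le> pmf p z * (pmf r z / pmf p z - 1)"
      using p by (intro mult_left_mono) auto
    then show "pmf p z - pmf r z \<le> pmf p z * ln (pmf p z / pmf r z)"
      using p r by (simp add: ln_div algebra_simps)
  qed
  moreover have "(\<Sum>z\<in>?A. pmf p z) = 1"
    by (rule sum_pmf_eq_1) (use fin in auto)
  moreover have "(\<Sum>z\<in>?A. pmf r z) \<le> 1"
    using measure_measure_pmf_finite[OF fin, of r] measure_pmf.prob_le_1[of r ?A] by simp
  ultimately have "0 \<le> (\<Sum>z\<in>?A. pmf p z * ln (pmf p z / pmf r z)) / ln 2"
    by (simp add: sum_subtractf)
  then show ?thesis
    by (simp add: rel_entropy_def log_def sum_divide_distrib)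
qed

lemma rel_entropy_self [simp]: "rel_entropy p p = 0"
  by (simp add: rel_entropy_def set_pmf_iff)

text \<open>Injectivity is asked on the support of \<open>r\<close>, not only of \<open>p\<close>,
  so that no further mass of \<open>r\<close> is merged into the image of a point of
  \<open>p\<close>.\<close>

lemma rel_entropy_map_inj:
  assumes "inj_on f (set_pmf r)" "set_pmf p \<subseteq> set_pmf r"
  shows "rel_entropy (map_pmf f p) (map_pmf f r) = rel_entropy p r"
proof -
  have inj: "inj_on f (set_pmf p)"
    using assms by (rule inj_on_subset)
  have "pmf (map_pmf f p) (f z) = pmf p z" "pmf (map_pmf f r) (f z) = pmf r z"
    if "z \<in> set_pmf p" for z
    using that assms inj by (auto intro!: pmf_map_inj)
  then show ?thesis
    by (simp add: rel_entropy_def sum.reindex[OF inj])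
qed

text \<open>The factor \<open>pmf P a\<close> cancels inside the logarithm and then sums to one: an
  output component independent of the message adds no divergence.\<close>

lemma rel_entropy_pair:
  assumes "finite (set_pmf P)" "finite (set_pmf p)"
  shows "rel_entropy (pair_pmf P p) (pair_pmf P r) = rel_entropy p r"
proof -
  have "rel_entropy (pair_pmf P p) (pair_pmf P r) =
    (\<Sum>a\<in>set_pmf P. \<Sum>z\<in>set_pmf p. pmf P a * (pmf p z * log 2 (pmf p z / pmf r z)))"
    unfolding rel_entropy_def set_pair_pmf sum.cartesian_product
    by (rule sum.cong) (auto simp: pmf_pair set_pmf_iff)
  also have "\<dots> = (\<Sum>a\<in>set_pmf P. pmf P a) * rel_entropy p r"
    unfolding rel_entropy_def by (rule sum_product[symmetric])
  also have "(\<Sum>a\<in>set_pmf P. pmf P a) = 1"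
    by (rule sum_pmf_eq_1) (use assms in auto)
  finally show ?thesis
    by simp
qed

lemma pmf_mixture: "1 \<le> J \<Longrightarrow> pmf (mixture J q) z = (\<Sum>j\<in>{1..J}. pmf (q j) z) / real J"
  by (simp add: mixture_def pmf_bind_pmf_of_set)

lemma set_pmf_mixture: "1 \<le> J \<Longrightarrow> set_pmf (mixture J q) = (\<Union>j\<in>{1..J}. set_pmf (q j))"
  by (simp add: mixture_def)

text \<open>
  The mixture is the reference distribution of least average divergence, because the two sides
  differ by \<open>J\<close> times \<open>rel_entropy (mixture J q) r\<close>. Hence any reference bounds the leakage.
\<close>

lemma rel_entropy_mixture_le:
  assumes J: "1 \<le> J" and fin: "\<And>j. j \<in> {1..J} \<Longrightarrow> finite (set_pmf (q j))"
    and ac: "\<And>j. j \<in> {1..J} \<Longrightarrow> set_pmf (q j) \<subseteq> set_pmf r"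
  shows "(\<Sum>j\<in>{1..J}. rel_entropy (q j) (mixture J q)) \<le> (\<Sum>j\<in>{1..J}. rel_entropy (q j) r)"
proof -
  let ?m = "mixture J q" and ?A = "\<Union>j\<in>{1..J}. set_pmf (q j)"
  have A: "finite ?A" "set_pmf ?m = ?A" "?A \<subseteq> set_pmf r"
    using fin J by (auto simp: set_pmf_mixture intro!: UN_least ac)
  have "(\<Sum>j\<in>{1..J}. rel_entropy (q j) r) - (\<Sum>j\<in>{1..J}. rel_entropy (q j) ?m)
    = (\<Sum>j\<in>{1..J}. \<Sum>z\<in>?A. pmf (q j) z * log 2 (pmf ?m z / pmf r z))"
    unfolding sum_subtractf[symmetric]
  proof (rule sum.cong[OF refl])
    fix j assume j: "j \<in> {1..J}"
    then have sub: "set_pmf (q j) \<subseteq> ?A"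
      by blast
    show "rel_entropy (q j) r - rel_entropy (q j) ?m
        = (\<Sum>z\<in>?A. pmf (q j) z * log 2 (pmf ?m z / pmf r z))"
      unfolding rel_entropy_superset[OF A(1) sub] sum_subtractf[symmetric]
    proof (rule sum.cong[OF refl])
      fix z assume z: "z \<in> ?A"
      then have pos: "pmf ?m z > 0" "pmf r z > 0"
        using A by (auto intro!: pmf_positive simp del: UN_iff)
      show "pmf (q j) z * log 2 (pmf (q j) z / pmf r z) - pmf (q j) z * log 2 (pmf (q j) z / pmf ?m z)
          = pmf (q j) z * log 2 (pmf ?m z / pmf r z)"
      proof (cases "pmf (q j) z = 0")
        case False
        then have "pmf (q j) z > 0"
          by (simp add: pmf_pos)
        then show ?thesis
          using pos by (simp add: log_divide algebra_simps)
      qed simp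
    qed
  qed
  also have "\<dots> = (\<Sum>z\<in>?A. (\<Sum>j\<in>{1..J}. pmf (q j) z) * log 2 (pmf ?m z / pmf r z))"
    by (subst sum.swap) (simp add: sum_distrib_right)
  also have "\<dots> = real J * rel_entropy ?m r"
    unfolding rel_entropy_def sum_distrib_left A(2)
    using J by (intro sum.cong) (auto simp: pmf_mixture)
  also have "\<dots> \<ge> 0"
    using A by (intro mult_nonneg_nonneg rel_entropy_nonneg) auto
  finally show ?thesis
    by simp
qed

section \<open>Error probability and leakage in terms of output laws\<close>

lemma pmf_channel_output:
  fixes e :: "(nat \<Rightarrow> 'a::finite) pmf"
  assumes "set_pmf e \<subseteq> words n"
  shows "pmf (channel_output W n e) z = (\<Sum>x\<in>words n. pmf e x * pmf (memoryless W n x) z)"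
  unfolding channel_output_def pmf_bind using assms
  by (subst integral_measure_pmf_real[of "words n"]) (auto simp: mult.commute)

lemma set_pmf_channel_output: "set_pmf (channel_output W n e) \<subseteq> words n"
  using set_pmf_memoryless by (fastforce simp: channel_output_def)

lemma finite_set_pmf_channel_output [simp]:
  "finite (set_pmf (channel_output (W :: _ \<Rightarrow> 'b::finite pmf) n e))"
  by (rule finite_subset[OF set_pmf_channel_output]) simp

lemma error_prob_eq:
  fixes E :: "nat \<Rightarrow> (nat \<Rightarrow> 'a::finite) pmf" and W :: "'a \<Rightarrow> 'b::finite pmf"
  assumes "set_pmf (E j) \<subseteq> words n"
  shows "error_prob n W E D j = measure_pmf.prob (channel_output W n (E j)) (words n - D j)"
  unfolding error_prob_def
  by (simp add: measure_measure_pmf_finite pmf_channel_output[OF assms] sum_distrib_left sum.swap[of _ "words n"])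

text \<open>For a uniform message the joint mass divided by both marginals is
  \<open>pmf (q j) z / pmf (mixture J q) z\<close>, since \<open>1 / real J\<close> cancels. Mutual
  information becomes an average divergence, which any reference law then bounds.\<close>

lemma leakage_eq_rel_entropy:
  fixes V :: "'a::finite \<Rightarrow> 'c::finite pmf"
  assumes J: "J \<ge> 1" and E: "encoder n J E"
  defines "q \<equiv> \<lambda>j. channel_output V n (E j)"
  shows "leakage n J V E = (\<Sum>j\<in>{1..J}. rel_entropy (q j) (mixture J q)) / real J"
proof -
  let ?p = "\<lambda>j z. 1 / real J * (\<Sum>x\<in>words n. pmf (E j) x * pmf (memoryless V n x) z)"
  have q: "?p j z = pmf (q j) z / real J" if "j \<in> {1..J}" for j z
    using E that by (auto simp: q_def encoder_def pmf_channel_output)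
  have sq: "set_pmf (q j) \<subseteq> words n" for j
    by (simp add: q_def set_pmf_channel_output)
  have m1: "(\<Sum>z\<in>words n. ?p j z) = 1 / real J" if "j \<in> {1..J}" for j
    using that sq by (subst sum.cong[OF refl q]) (auto simp: sum_pmf_eq_1 simp flip: sum_divide_distrib)
  have m2: "(\<Sum>j\<in>{1..J}. ?p j z) = pmf (mixture J q) z" for z
    by (subst sum.cong[OF refl q]) (use J in \<open>auto simp: pmf_mixture simp flip: sum_divide_distrib\<close>)
  have "leakage n J V E = (\<Sum>j\<in>{1..J}. \<Sum>z\<in>words n.
      ?p j z * log 2 (?p j z / ((\<Sum>z\<in>words n. ?p j z) * (\<Sum>j\<in>{1..J}. ?p j z))))"
    unfolding leakage_eq[OF J E] by (rule sum.cartesian_product[symmetric])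
  also have "\<dots> = (\<Sum>j\<in>{1..J}. rel_entropy (q j) (mixture J q) / real J)"
  proof (rule sum.cong[OF refl])
    fix j assume j: "j \<in> {1..J}"
    show "(\<Sum>z\<in>words n. ?p j z * log 2 (?p j z / ((\<Sum>z\<in>words n. ?p j z) * (\<Sum>j\<in>{1..J}. ?p j z))))
        = rel_entropy (q j) (mixture J q) / real J"
      unfolding m1[OF j] m2
      unfolding q[OF j] rel_entropy_superset[OF finite_words sq] sum_divide_distrib
      using J by (intro sum.cong) auto
  qed
  finally show ?thesis
    by (simp add: sum_divide_distrib)
qed

lemma leakage_nonneg:
  fixes V :: "'a::finite \<Rightarrow> 'c::finite pmf"
  assumes "J \<ge> 1" "encoder n J E"
  shows "0 \<le> leakage n J V E"
  unfolding leakage_eq_rel_entropy[OF assms] using assms(1)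
  by (intro divide_nonneg_nonneg sum_nonneg rel_entropy_nonneg) (auto simp: set_pmf_mixture)

lemma error_prob_nonneg: "0 \<le> error_prob n W E D j"
  unfolding error_prob_def by (intro sum_nonneg mult_nonneg_nonneg) auto

section \<open>Concatenation of words\<close>

lemma append_word_in_words:
  "u \<in> words k \<Longrightarrow> v \<in> words m \<Longrightarrow> append_word k u v \<in> words (k + m)"
  by (auto simp: words_def append_word_def PiE_iff extensional_def)

text \<open>A shift by \<open>k\<close> recovers the second component completely, hence
  \<open>UNIV\<close>; of the first only the values below \<open>k\<close> survive, so it must be a
  word.\<close>

lemma inj_on_append_word: "inj_on (\<lambda>(u, v). append_word k u v) (words k \<times> UNIV)"
proof (rule inj_onI, clarify)
  fix u u' :: "nat \<Rightarrow> 'a" and v v' :: "nat \<Rightarrow> 'a"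
  assume u: "u \<in> words k" "u' \<in> words k" and eq: "append_word k u v = append_word k u' v'"
  have "u i = u' i" for i
    using u fun_cong[OF eq, of i] by (cases "i < k") (auto simp: append_word_def words_def PiE_iff extensional_def)
  moreover have "v i = v' i" for i
    using fun_cong[OF eq, of "i + k"] by (simp add: append_word_def)
  ultimately show "u = u' \<and> v = v'"
    by (simp add: fun_eq_iff)
qed

lemma words_append_cases:
  assumes "z \<in> words (k + m)"
  obtains u v where "z = append_word k u v" "u \<in> words k" "v \<in> words m"
proof
  show "z = append_word k (\<lambda>i. if i < k then z i else undefined) (\<lambda>i. z (i + k))"
    by (auto simp: append_word_def fun_eq_iff)
qed (use assms in \<open>auto simp: words_def PiE_iff extensional_def\<close>)

text \<open>Distinct positions are independent, so the product of transition probabilities splits at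
  position \<open>k\<close>. Outside \<open>words (k + m)\<close> both sides have mass zero.\<close>

lemma memoryless_append_word:
  "memoryless W (k + m) (append_word k u v)
    = map_pmf (\<lambda>(a, b). append_word k a b) (pair_pmf (memoryless W k u) (memoryless W m v))"
  (is "?l = map_pmf ?f ?r")
proof (rule pmf_eqI)
  fix z
  have sr: "set_pmf ?r \<subseteq> words k \<times> words m"
    using set_pmf_memoryless by (fastforce simp: set_pair_pmf)
  show "pmf ?l z = pmf (map_pmf ?f ?r) z"
  proof (cases "z \<in> words (k + m)")
    case False
    then have "z \<notin> set_pmf ?l" "z \<notin> set_pmf (map_pmf ?f ?r)"
      using set_pmf_memoryless[of W "k + m"] sr append_word_in_words by fastforce+
    then show ?thesis
      by (metis pmf_eq_0_set_pmf)
  next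
    case True
    then obtain a b where z: "z = append_word k a b" and ab: "a \<in> words k" "b \<in> words m"
      by (rule words_append_cases)
    have "pmf ?l z = (\<Prod>i<k + m. pmf (W (append_word k u v i)) (append_word k a b i))"
      using True by (simp add: pmf_memoryless z)
    also have "\<dots> = (\<Prod>i<k. pmf (W (append_word k u v i)) (append_word k a b i)) *
        (\<Prod>i\<in>{k..<k + m}. pmf (W (append_word k u v i)) (append_word k a b i))"
      by (subst prod.union_disjoint[symmetric]) (auto intro!: prod.cong)
    also have "\<dots> = (\<Prod>i<k. pmf (W (u i)) (a i)) * (\<Prod>i<m. pmf (W (v i)) (b i))"
      using prod.shift_bounds_nat_ivl[of "\<lambda>i. pmf (W (append_word k u v i)) (append_word k a b i)" 0 k m]
      by (simp add: append_word_def add.commute lessThan_atLeast0)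
    also have "\<dots> = pmf ?r (a, b)"
      using ab by (simp add: pmf_pair pmf_memoryless)
    \<comment> \<open>Off the support of \<open>?r\<close> injectivity is still used, to see that no
      other pair is mapped to the same word.\<close>
    also have "\<dots> = pmf (map_pmf ?f ?r) (?f (a, b))"
    proof (cases "(a, b) \<in> set_pmf ?r")
      case True
      have "inj_on ?f (set_pmf ?r)"
        by (rule inj_on_subset[OF inj_on_append_word]) (use sr in auto)
      then show ?thesis
        using True by (rule pmf_map_inj[symmetric])
    next
      case False
      then have "?f (a, b) \<notin> ?f ` set_pmf ?r"
        using sr ab inj_on_append_word[of k] by (subst inj_on_image_mem_iff[where B = "words k \<times> UNIV"]) auto
      then show ?thesis
        using False by (metis pmf_eq_0_set_pmf pmf_map_outside)
    qed
    finally show ?thesis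
      by (simp add: z)
  qed
qed

text \<open>The prefix \<open>u\<close> is deterministic, so its output is independent of everything
  drawn from \<open>e\<close>, in particular of the message.\<close>

lemma channel_output_append_word:
  "channel_output W (k + m) (map_pmf (append_word k u) e)
    = map_pmf (\<lambda>(a, b). append_word k a b) (pair_pmf (memoryless W k u) (channel_output W m e))"
  unfolding channel_output_def bind_map_pmf memoryless_append_word
  by (simp add: pair_pmf_def map_bind_pmf bind_assoc_pmf bind_commute_pmf[of e])

section \<open>Announcing the channel state\<close>

lemma map_pmf_eq_bernoulli: "map_pmf (\<lambda>b. b = c) p = bernoulli_pmf (pmf p c)"
proof (rule pmf_eqI)
  have "pmf (map_pmf (\<lambda>b. b = c) p) True = pmf p c"
    by (simp add: pmf_map vimage_def pmf.rep_eq)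
  moreover have "pmf (map_pmf (\<lambda>b. b = c) p) False = 1 - pmf (map_pmf (\<lambda>b. b = c) p) True"
    using sum_pmf_eq_1[OF finite subset_UNIV, of "map_pmf (\<lambda>b. b = c) p"] by (simp add: UNIV_bool)
  ultimately show "pmf (map_pmf (\<lambda>b. b = c) p) x = pmf (bernoulli_pmf (pmf p c)) x" for x
    by (cases x) (simp_all add: pmf_le_1)
qed

text \<open>Positions of \<open>I\<close> share one output law, so the events \<open>y i = c\<close>
  are independent Bernoulli trials.\<close>

lemma map_pmf_count_memoryless:
  assumes I: "I \<subseteq> {..<n}" and W: "\<And>i. i \<in> I \<Longrightarrow> W (x i) = p"
  shows "map_pmf (\<lambda>y. card {i\<in>I. y i = c}) (memoryless W n x) = binomial_pmf (card I) (pmf p c)"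
proof -
  have fin: "finite I"
    using I by (rule finite_subset) simp
  \<comment> \<open>The default \<open>undefined = c\<close> is the image of the default
    \<open>undefined\<close> under the test for \<open>c\<close>, as mapping a product
    coordinatewise requires.\<close>
  have "binomial_pmf (card I) (pmf p c)
      = map_pmf (\<lambda>f. card {i\<in>I. f i}) (Pi_pmf I (undefined = c) (\<lambda>i. map_pmf (\<lambda>b. b = c) (W (x i))))"
    using fin W
    by (subst binomial_pmf_altdef'[where A = I and dflt = "undefined = c"])
       (auto simp: pmf_le_1 map_pmf_eq_bernoulli cong: Pi_pmf_cong)
  also have "\<dots> = map_pmf (\<lambda>y. card {i\<in>I. y i = c}) (Pi_pmf I undefined (\<lambda>i. W (x i)))"
    by (subst Pi_pmf_map[OF fin refl]) (simp add: pmf.map_comp o_def)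
  also have "\<dots> = map_pmf (\<lambda>y. card {i\<in>I. y i = c}) (memoryless W n x)"
    unfolding memoryless_def using I
    by (subst Pi_pmf_subset[of "{..<n}" I])
       (auto simp: pmf.map_comp o_def intro!: map_pmf_cong arg_cong[where f = card])
  finally show ?thesis ..
qed

text \<open>Hoeffding's inequality for the binomial count; for an empty block the bound is two and
  holds trivially.\<close>

lemma memoryless_frequency:
  assumes "I \<subseteq> {..<n}" and "\<And>i. i \<in> I \<Longrightarrow> W (x i) = p" and "card I = m" and \<delta>: "0 \<le> \<delta>"
  shows "measure_pmf.prob (memoryless W n x) {y. \<delta> \<le> \<bar>real (card {i\<in>I. y i = c}) / real m - pmf p c\<bar>}
    \<le> 2 * exp (- 2 * real m * \<delta>\<^sup>2)"
proof (cases "m = 0")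
  case True
  then show ?thesis
    by (simp add: order_trans[OF measure_pmf.prob_le_1])
next
  case False
  interpret binomial_distribution m "pmf p c"
    by standard (simp add: pmf_le_1)
  have "measure_pmf.prob (memoryless W n x) {y. \<delta> \<le> \<bar>real (card {i\<in>I. y i = c}) / real m - pmf p c\<bar>}
    = measure_pmf.prob (map_pmf (\<lambda>y. card {i\<in>I. y i = c}) (memoryless W n x))
        {k. \<delta> \<le> \<bar>real k / real m - pmf p c\<bar>}"
    by (simp add: vimage_def)
  also have "\<dots> = measure_pmf.prob (binomial_pmf m (pmf p c)) {k. \<delta> \<le> \<bar>real k / real m - pmf p c\<bar>}"
    using assms by (subst map_pmf_count_memoryless[of I n W x p c]) simp_all
  also have "\<dots> \<le> 2 * exp (- 2 * real m * \<delta>\<^sup>2)"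
    using prob_abs_ge'[of \<delta>] False \<delta> by simp
  finally show ?thesis .
qed

text \<open>
  The state is announced by pulse position: block \<open>t\<close> uses another input letter than all
  other blocks, block \<open>0\<close> serving as the reference. The receiver, who does not know which
  letters are used, only looks for a block whose empirical distribution differs from that of
  block \<open>0\<close>.
\<close>

lemma state_announcement:
  fixes W :: "nat \<Rightarrow> 'a \<Rightarrow> 'b::finite pmf"
  assumes nonconst: "\<And>t. t \<in> {1..T} \<Longrightarrow> \<exists>a b. W t a \<noteq> W t b"
  obtains u :: "nat \<Rightarrow> nat \<Rightarrow> nat \<Rightarrow> 'a" and G :: "nat \<Rightarrow> nat \<Rightarrow> (nat \<Rightarrow> 'b) set" and err :: "nat \<Rightarrow> real"
  where "\<And>m t. u m t \<in> words (m * (T + 1))" "\<And>m t. G m t \<subseteq> words (m * (T + 1))"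
    "\<And>m. disjoint_family_on (G m) {1..T}" "err \<longlonglongrightarrow> 0"
    "\<And>m t. t \<in> {1..T} \<Longrightarrow> measure_pmf.prob (memoryless (W t) (m * (T + 1)) (u m t))
       (words (m * (T + 1)) - G m t) \<le> err m"
proof -
  have "\<forall>t\<in>{1..T}. \<exists>a b c. pmf (W t a) c \<noteq> pmf (W t b) c"
    using nonconst by (metis pmf_eqI)
  then obtain a b c where abc: "\<And>t. t \<in> {1..T} \<Longrightarrow> pmf (W t (a t)) (c t) \<noteq> pmf (W t (b t)) (c t)"
    by metis
  define gap where "gap t = \<bar>pmf (W t (a t)) (c t) - pmf (W t (b t)) (c t)\<bar>" for t
  \<comment> \<open>If both frequencies err by less than \<open>\<delta>\<close>, a gap of
    \<open>4 * \<delta>\<close> still shows as more than \<open>2 * \<delta>\<close>, while equal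
    laws stay below \<open>2 * \<delta>\<close>. The inserted \<open>1\<close> keeps the minimum
    defined when \<open>T = 0\<close>.\<close>
  define \<delta> where "\<delta> = Min (insert 1 (gap ` {1..T})) / 4"
  have \<delta>: "\<delta> > 0"
    using abc by (auto simp: \<delta>_def gap_def)
  have \<delta>_gap: "4 * \<delta> \<le> gap t" if "t \<in> {1..T}" for t
  proof -
    have "Min (insert 1 (gap ` {1..T})) \<le> gap t"
      using that by (intro Min_le) auto
    then show ?thesis
      unfolding \<delta>_def by linarith
  qed
  define I where "I m i = {i * m..<(i + 1) * m}" for m i :: nat
  define freq where "freq m y i d = real (card {p \<in> I m i. y p = d}) / real m"
    for m i and y :: "nat \<Rightarrow> 'b" and d
  \<comment> \<open>Every letter \<open>d\<close> is tested because the distinguishing letter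
    \<open>c t\<close> depends on the state, unknown to the receiver.\<close>
  define detect where "detect m y i \<longleftrightarrow> (\<exists>d. 2 * \<delta> < \<bar>freq m y i d - freq m y 0 d\<bar>)" for m y i
  define letter where "letter t i = (if i = t then a t else b t)" for t i
  define u where "u m t p = (if p < m * (T + 1) then letter t (p div m) else undefined)" for m t p
  \<comment> \<open>Demanding that no other block be detected makes these sets disjoint.\<close>
  define G where "G m t = {y \<in> words (m * (T + 1)). detect m y t \<and> (\<forall>i\<in>{1..T} - {t}. \<not> detect m y i)}"
    for m t
  define bad where "bad m t i d = {y. \<delta> \<le> \<bar>freq m y i d - pmf (W t (letter t i)) d\<bar>}" for m t i d
  \<comment> \<open>Union bound over all \<open>T + 1\<close> blocks and all output letters.\<close>
  define err where "err m = real (card ({0..T} \<times> (UNIV :: 'b set))) * (2 * exp (- 2 * real m * \<delta>\<^sup>2))" for m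
  have I: "I m i \<subseteq> {..<m * (T + 1)}" "card (I m i) = m"
      "\<And>p. p \<in> I m i \<Longrightarrow> u m t p = letter t i" if "i \<in> {0..T}" for m i t
  proof -
    have le: "(i + 1) * m \<le> m * (T + 1)"
      using that by (subst mult.commute) (intro mult_le_mono2, simp)
    then show *: "I m i \<subseteq> {..<m * (T + 1)}"
      unfolding I_def by (meson atLeastLessThan_iff lessThan_iff order.strict_trans2 subsetI)
    show "card (I m i) = m"
      by (simp add: I_def)
    show "u m t p = letter t i" if "p \<in> I m i" for p
    proof -
      have "p div m = i"
        using that by (intro div_nat_eqI) (auto simp: I_def mult.commute)
      then show ?thesis
        using that * by (auto simp: u_def)
    qed
  qed
  show ?thesis
  proof (rule that)
    show "u m t \<in> words (m * (T + 1))" for m t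
      by (auto simp: u_def words_def PiE_iff extensional_def)
    show "G m t \<subseteq> words (m * (T + 1))" for m t
      by (auto simp: G_def)
    show "disjoint_family_on (G m) {1..T}" for m
      by (auto simp: G_def disjoint_family_on_def)
    show "err \<longlonglongrightarrow> 0"
      unfolding err_def using \<delta> by real_asymp
  next
    fix m t assume t: "t \<in> {1..T}"
    let ?M = "memoryless (W t) (m * (T + 1)) (u m t)"
    \<comment> \<open>If all frequencies are within \<open>\<delta>\<close> of their laws, block
      \<open>t\<close> and no other is detected.\<close>
    have "words (m * (T + 1)) - G m t \<subseteq> (\<Union>(i, d)\<in>{0..T} \<times> UNIV. bad m t i d)"
    proof (rule subsetI, rule ccontr)
      fix y assume y: "y \<in> words (m * (T + 1)) - G m t" "y \<notin> (\<Union>(i, d)\<in>{0..T} \<times> UNIV. bad m t i d)"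
      then have good: "\<bar>freq m y i d - pmf (W t (letter t i)) d\<bar> < \<delta>" if "i \<in> {0..T}" for i d
      proof -
        have "y \<notin> bad m t i d"
          using that y(2) by blast
        then show ?thesis
          by (simp add: bad_def)
      qed
      have "4 * \<delta> \<le> \<bar>pmf (W t (letter t t)) (c t) - pmf (W t (letter t 0)) (c t)\<bar>"
        using \<delta>_gap[OF t] t by (simp add: gap_def letter_def)
      then have "2 * \<delta> < \<bar>freq m y t (c t) - freq m y 0 (c t)\<bar>"
        using good[of t "c t"] good[of 0 "c t"] t by simp
      then have "detect m y t"
        by (auto simp: detect_def)
      moreover have "\<not> detect m y i" if i: "i \<in> {1..T} - {t}" for i
      proof -
        have "\<bar>freq m y i d - freq m y 0 d\<bar> < 2 * \<delta>" for d
          using good[of i d] good[of 0 d] i t by (simp add: letter_def)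
        then show ?thesis
          by (auto simp: detect_def not_less less_imp_le)
      qed
      ultimately show False
        using y(1) by (auto simp: G_def)
    qed
    then have "measure_pmf.prob ?M (words (m * (T + 1)) - G m t)
        \<le> measure_pmf.prob ?M (\<Union>(i, d)\<in>{0..T} \<times> UNIV. bad m t i d)"
      by (intro measure_pmf.finite_measure_mono) auto
    also have "\<dots> \<le> (\<Sum>(i, d)\<in>{0..T} \<times> UNIV. measure_pmf.prob ?M (bad m t i d))"
      using measure_pmf.finite_measure_subadditive_finite[of "{0..T} \<times> (UNIV :: 'b set)" "\<lambda>(i, d). bad m t i d" ?M]
      by (simp add: case_prod_beta)
    also have "\<dots> \<le> (\<Sum>(i, d)\<in>{0..T} \<times> (UNIV :: 'b set). 2 * exp (- 2 * real m * \<delta>\<^sup>2))"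
    proof (rule sum_mono, clarify)
      fix i d assume "i \<in> {0..T}"
      note I = I[OF this]
      show "measure_pmf.prob ?M (bad m t i d) \<le> 2 * exp (- 2 * real m * \<delta>\<^sup>2)"
        unfolding bad_def freq_def using \<delta>
        by (intro memoryless_frequency I) (auto simp: I)
    qed
    also have "\<dots> = err m"
      by (simp add: err_def case_prod_beta)
    finally show "measure_pmf.prob ?M (words (m * (T + 1)) - G m t) \<le> err m" .
  qed
qed

section \<open>Combining codes for the individual states\<close>

text \<open>Dropping a largest element never raises the average; \<open>d\<close> removals leave
  \<open>K\<close> elements. Multiplying out the averages also covers \<open>K = 0\<close>.\<close>

lemma exists_subset_small_sum:
  fixes f :: "'i \<Rightarrow> real"
  assumes "finite A" "card A = K + d"
  shows "\<exists>B\<subseteq>A. card B = K \<and> real (card A) * sum f B \<le> real K * sum f A"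
  using assms
proof (induction d arbitrary: A)
  case 0
  then show ?case
    by auto
next
  case (Suc d)
  obtain x where x: "x \<in> A" "\<And>y. y \<in> A \<Longrightarrow> f y \<le> f x"
  proof -
    have "Max (f ` A) \<in> f ` A"
      using Suc.prems by (intro Max_in) auto
    then obtain x where "x \<in> A" "f x = Max (f ` A)"
      by (metis imageE)
    then show thesis
      using Suc.prems by (intro that[of x]) (auto intro: Max_ge)
  qed
  have "card (A - {x}) = K + d"
    using Suc.prems x by simp
  then obtain B where B: "B \<subseteq> A - {x}" "card B = K" "real (K + d) * sum f B \<le> real K * sum f (A - {x})"
    using Suc.IH[of "A - {x}"] Suc.prems by auto
  have "sum f B \<le> real K * f x"
    using sum_bounded_above[of B f "f x"] x B by auto
  then have "real (card A) * sum f B \<le> real K * sum f (A - {x}) + real K * f x"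
    using B(3) Suc.prems(2) by (simp add: algebra_simps)
  also have "\<dots> = real K * sum f A"
    using Suc.prems x by (simp add: sum.remove[of A x] algebra_simps)
  finally show ?case
    using B by blast
qed

text \<open>Numbering the subset by \<open>{1..K}\<close> lets it serve as a message set.\<close>

lemma exists_selection_small_average:
  fixes f :: "nat \<Rightarrow> real"
  assumes "1 \<le> K" "K \<le> J"
  obtains \<sigma> where "inj_on \<sigma> {1..K}" "\<sigma> ` {1..K} \<subseteq> {1..J}"
    "(\<Sum>j\<in>{1..K}. f (\<sigma> j)) / real K \<le> (\<Sum>j\<in>{1..J}. f j) / real J"
proof -
  obtain B where B: "B \<subseteq> {1..J}" "card B = K" "real J * sum f B \<le> real K * sum f {1..J}"
    using exists_subset_small_sum[of "{1..J}" K "J - K" f] assms by auto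
  moreover have "finite B"
    using B(1) finite_subset by blast
  then obtain \<sigma> where \<sigma>: "bij_betw \<sigma> {1..K} B"
    using ex_bij_betw_nat_finite_1[of B] B(2) by auto
  have "(\<Sum>j\<in>{1..K}. f (\<sigma> j)) = sum f B"
    by (rule sum.reindex_bij_betw[OF \<sigma>])
  moreover have "real J * sum f B / (real K * real J) \<le> real K * sum f {1..J} / (real K * real J)"
    using B(3) by (rule divide_right_mono) simp
  ultimately have "(\<Sum>j\<in>{1..K}. f (\<sigma> j)) / real K \<le> (\<Sum>j\<in>{1..J}. f j) / real J"
    using assms by simp
  then show thesis
    using that[of \<sigma>] \<sigma> B(1) by (simp add: bij_betw_def)
qed

text \<open>
  The common message set of size \<open>K\<close> is embedded in that of the code for \<open>t\<close> by \<open>\<sigma> t\<close>, which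
  selects messages of small divergence summed over \<open>s\<close>, so that one selection serves all
  eavesdroppers. The output of the prefix is independent of the message and does not contribute
  to the divergences.
\<close>

lemma combine_codes:
  fixes W :: "nat \<Rightarrow> 'a::finite \<Rightarrow> 'b::finite pmf" and V :: "nat \<Rightarrow> 'a \<Rightarrow> 'c::finite pmf"
    and u :: "nat \<Rightarrow> nat \<Rightarrow> 'a" and D :: "nat \<Rightarrow> nat \<Rightarrow> (nat \<Rightarrow> 'b) set"
  assumes u: "\<And>t. u t \<in> words k"
    and G: "disjoint_family_on G {1..T}" "\<And>t. G t \<subseteq> words k"
    and K: "1 \<le> K" "\<And>t. t \<in> {1..T} \<Longrightarrow> K \<le> J t"
    and E: "\<And>t. t \<in> {1..T} \<Longrightarrow> encoder m (J t) (E t)"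
    and D: "\<And>t. t \<in> {1..T} \<Longrightarrow> decoding_sets m (J t) (D t)"
  obtains E' D' where
    "\<And>t. t \<in> {1..T} \<Longrightarrow> encoder (k + m) K (E' t)" "decoding_sets (k + m) K D'"
    "\<And>t j. t \<in> {1..T} \<Longrightarrow> j \<in> {1..K} \<Longrightarrow> error_prob (k + m) (W t) (E' t) D' j
      \<le> measure_pmf.prob (memoryless (W t) k (u t)) (words k - G t)
        + (MAX i\<in>{1..J t}. error_prob m (W t) (E t) (D t) i)"
    "\<And>t s. t \<in> {1..T} \<Longrightarrow> s \<in> {1..S} \<Longrightarrow>
      leakage (k + m) K (V s) (E' t) \<le> (\<Sum>s\<in>{1..S}. leakage m (J t) (V s) (E t))"
proof -
  define q where "q t s j = channel_output (V s) m (E t j)" for t s j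
  define f where "f t s j = rel_entropy (q t s j) (mixture (J t) (q t s))" for t s j
  have J: "1 \<le> J t" if "t \<in> {1..T}" for t
    using K(1) K(2)[OF that] by linarith
  define selects where "selects t \<sigma> \<longleftrightarrow> inj_on \<sigma> {1..K} \<and> \<sigma> ` {1..K} \<subseteq> {1..J t} \<and>
      (\<Sum>j\<in>{1..K}. \<Sum>s\<in>{1..S}. f t s (\<sigma> j)) / real K \<le> (\<Sum>j\<in>{1..J t}. \<Sum>s\<in>{1..S}. f t s j) / real (J t)"
    for t \<sigma>
  have "\<exists>\<sigma>. selects t \<sigma>" if t: "t \<in> {1..T}" for t
  proof -
    obtain \<sigma> where "inj_on \<sigma> {1..K}" "\<sigma> ` {1..K} \<subseteq> {1..J t}"
        "(\<Sum>j\<in>{1..K}. \<Sum>s\<in>{1..S}. f t s (\<sigma> j)) / real K \<le> (\<Sum>j\<in>{1..J t}. \<Sum>s\<in>{1..S}. f t s j) / real (J t)"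
      by (rule exists_selection_small_average[OF K(1) K(2)[OF t]])
    then have "selects t \<sigma>"
      unfolding selects_def by blast
    then show ?thesis
      by (rule exI[where x = \<sigma>])
  qed
  then obtain \<sigma> where "\<And>t. t \<in> {1..T} \<Longrightarrow> selects t (\<sigma> t)"
    by metis
  then have \<sigma>: "inj_on (\<sigma> t) {1..K}" "\<sigma> t ` {1..K} \<subseteq> {1..J t}"
      "(\<Sum>j\<in>{1..K}. \<Sum>s\<in>{1..S}. f t s (\<sigma> t j)) / real K
        \<le> (\<Sum>j\<in>{1..J t}. \<Sum>s\<in>{1..S}. f t s j) / real (J t)" if "t \<in> {1..T}" for t
    using that by (simp_all only: selects_def)
  have \<sigma>_in: "\<sigma> t j \<in> {1..J t}" if "t \<in> {1..T}" "j \<in> {1..K}" for t j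
    using \<sigma>(2)[OF that(1)] that(2) by blast
  let ?app = "\<lambda>(a, b). append_word k a b"
  define E' where "E' t j = map_pmf (append_word k (u t)) (E t (\<sigma> t j))" for t j
  \<comment> \<open>The receiver reads the state off the prefix and then decodes with that state's
    code; the union over \<open>t\<close> makes the sets independent of the state.\<close>
  define D' where "D' j = (\<Union>t\<in>{1..T}. (\<lambda>(a, b). append_word k a b) ` (G t \<times> D t (\<sigma> t j)))" for j
  have E_words: "set_pmf (E t (\<sigma> t j)) \<subseteq> words m" if "t \<in> {1..T}" "j \<in> {1..K}" for t j
    using E[OF that(1)] \<sigma>_in[OF that] by (auto simp: encoder_def)
  have E'_words: "set_pmf (E' t j) \<subseteq> words (k + m)" if "t \<in> {1..T}" "j \<in> {1..K}" for t j
    using E_words[OF that] append_word_in_words[OF u] by (auto simp: E'_def)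
  have D_words: "D t (\<sigma> t j) \<subseteq> words m" if "t \<in> {1..T}" "j \<in> {1..K}" for t j
    using D[OF that(1)] \<sigma>_in[OF that] by (auto simp: decoding_sets_def)
  show thesis
  proof (rule that)
    show enc: "encoder (k + m) K (E' t)" if "t \<in> {1..T}" for t
      using E'_words[OF that] by (simp add: encoder_def)
    show "decoding_sets (k + m) K D'"
      unfolding decoding_sets_def
    proof
      show "\<forall>j\<in>{1..K}. D' j \<subseteq> words (k + m)"
        using D_words G(2) by (fastforce simp: D'_def intro!: append_word_in_words)
      show "disjoint_family_on D' {1..K}"
        unfolding disjoint_family_on_def
      proof (intro ballI impI, rule ccontr)
        fix j j' assume j: "j \<in> {1..K}" "j' \<in> {1..K}" "j \<noteq> j'" and "D' j \<inter> D' j' \<noteq> {}"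
        then obtain z where z: "z \<in> D' j" "z \<in> D' j'"
          by blast
        obtain t a b where 1: "t \<in> {1..T}" "a \<in> G t" "b \<in> D t (\<sigma> t j)" "z = append_word k a b"
          using z(1) by (auto simp: D'_def)
        obtain t' a' b' where 2: "t' \<in> {1..T}" "a' \<in> G t'" "b' \<in> D t' (\<sigma> t' j')"
            "z = append_word k a' b'"
          using z(2) by (auto simp: D'_def)
        \<comment> \<open>Unique splitting makes the prefixes agree, which fixes the state; then two
          different messages of one code would share the output \<open>b\<close>.\<close>
        have "(a, b) = (a', b')"
        proof (rule inj_onD[OF inj_on_append_word[of k]])
          show "(a, b) \<in> words k \<times> UNIV" "(a', b') \<in> words k \<times> UNIV"
            using 1(2) 2(2) G(2) by blast+
        qed (use 1(4) 2(4) in simp)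
        then have [simp]: "a' = a" "b' = b"
          by auto
        have "t = t'"
          using disjoint_family_onD[OF G(1) 1(1) 2(1)] 1(2) 2(2) by auto
        moreover have "\<sigma> t j \<noteq> \<sigma> t j'"
          using \<sigma>(1)[OF 1(1)] j by (auto dest: inj_onD)
        moreover have "disjoint_family_on (D t) {1..J t}"
          using D[OF 1(1)] by (simp add: decoding_sets_def)
        ultimately have "D t (\<sigma> t j) \<inter> D t (\<sigma> t j') = {}"
          using \<sigma>_in[OF 1(1)] j by (intro disjoint_family_onD)
        then show False
          using 1(3) 2(3) \<open>t = t'\<close> by auto
      qed
    qed
  next
    fix t j assume t: "t \<in> {1..T}" and j: "j \<in> {1..K}"
    let ?P = "memoryless (W t) k (u t)" and ?Q = "channel_output (W t) m (E t (\<sigma> t j))"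
    have "error_prob (k + m) (W t) (E' t) D' j
        = measure_pmf.prob (pair_pmf ?P ?Q) (?app -` (words (k + m) - D' j))"
      unfolding error_prob_eq[where E = "E' t", OF E'_words[OF t j]]
      by (simp add: E'_def channel_output_append_word)
    \<comment> \<open>On the support both parts are words, so missing \<open>D' j\<close> means that
      the prefix misses \<open>G t\<close> or the rest misses
      \<open>D t (\<sigma> t j)\<close>.\<close>
    also have "\<dots> = measure_pmf.prob (pair_pmf ?P ?Q)
        (?app -` (words (k + m) - D' j) \<inter> set_pmf (pair_pmf ?P ?Q))"
      by (rule measure_Int_set_pmf[symmetric])
    also have "\<dots> \<le> measure_pmf.prob (pair_pmf ?P ?Q)
        (fst -` (words k - G t) \<union> snd -` (words m - D t (\<sigma> t j)))"
    proof (rule measure_pmf.finite_measure_mono)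
      show "?app -` (words (k + m) - D' j) \<inter> set_pmf (pair_pmf ?P ?Q)
          \<subseteq> fst -` (words k - G t) \<union> snd -` (words m - D t (\<sigma> t j))"
        using t set_pmf_memoryless[of "W t" k "u t"] set_pmf_channel_output[of "W t" m "E t (\<sigma> t j)"]
        by (fastforce simp: D'_def)
    qed simp
    also have "\<dots> \<le> measure_pmf.prob (pair_pmf ?P ?Q) (fst -` (words k - G t))
        + measure_pmf.prob (pair_pmf ?P ?Q) (snd -` (words m - D t (\<sigma> t j)))"
      by (rule measure_Un_le) simp_all
    also have "\<dots> = measure_pmf.prob ?P (words k - G t) + measure_pmf.prob ?Q (words m - D t (\<sigma> t j))"
      by (simp flip: measure_map_pmf add: map_fst_pair_pmf map_snd_pair_pmf)
    also have "measure_pmf.prob ?Q (words m - D t (\<sigma> t j)) = error_prob m (W t) (E t) (D t) (\<sigma> t j)"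
      by (rule error_prob_eq[where E = "E t", OF E_words[OF t j], symmetric])
    also have "\<dots> \<le> (MAX i\<in>{1..J t}. error_prob m (W t) (E t) (D t) i)"
      using \<sigma>_in[OF t j] by (intro Max_ge) auto
    finally show "error_prob (k + m) (W t) (E' t) D' j
      \<le> measure_pmf.prob ?P (words k - G t) + (MAX i\<in>{1..J t}. error_prob m (W t) (E t) (D t) i)"
      by simp
  next
    fix t s assume t: "t \<in> {1..T}" and s: "s \<in> {1..S}"
    let ?P = "memoryless (V s) k (u t)"
    define q' where "q' j = channel_output (V s) (k + m) (E' t j)" for j
    \<comment> \<open>The reference mixes over all \<open>J t\<close> messages, not just the
      \<open>K\<close> selected ones, so that each divergence equals the corresponding one of the
      original code.\<close>
    define r where "r = map_pmf ?app (pair_pmf ?P (mixture (J t) (q t s)))"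
    have finP: "finite (set_pmf ?P)"
      by (rule finite_subset[OF set_pmf_memoryless]) simp
    have finq: "finite (set_pmf (q t s j))" for s j
      by (simp add: q_def)
    have q': "q' j = map_pmf ?app (pair_pmf ?P (q t s (\<sigma> t j)))" for j
      by (simp add: q'_def E'_def q_def channel_output_append_word)
    have ac: "set_pmf (q t s (\<sigma> t j)) \<subseteq> set_pmf (mixture (J t) (q t s))" if "j \<in> {1..K}" for j s
      unfolding set_pmf_mixture[OF J[OF t]] using \<sigma>_in[OF t that] by blast
    have f_nonneg: "0 \<le> f t s (\<sigma> t j)" if "j \<in> {1..K}" for s j
      unfolding f_def by (intro rel_entropy_nonneg ac[OF that] finq)
    have rel: "rel_entropy (q' j) r = f t s (\<sigma> t j)" if "j \<in> {1..K}" for j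
    proof -
      have "inj_on ?app (set_pmf (pair_pmf ?P (mixture (J t) (q t s))))"
        by (rule inj_on_subset[OF inj_on_append_word]) (use set_pmf_memoryless in fastforce)
      then have "rel_entropy (q' j) r = rel_entropy (pair_pmf ?P (q t s (\<sigma> t j))) (pair_pmf ?P (mixture (J t) (q t s)))"
        unfolding q' r_def using ac[OF that] by (intro rel_entropy_map_inj) auto
      then show ?thesis
        by (simp add: rel_entropy_pair finP finq f_def)
    qed
    have enc': "encoder (k + m) K (E' t)"
      using E'_words[OF t] by (simp add: encoder_def)
    have "leakage (k + m) K (V s) (E' t) = (\<Sum>j\<in>{1..K}. rel_entropy (q' j) (mixture K q')) / real K"
      unfolding leakage_eq_rel_entropy[OF K(1) enc'] q'_def ..
    also have "\<dots> \<le> (\<Sum>j\<in>{1..K}. rel_entropy (q' j) r) / real K"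
    proof (intro divide_right_mono rel_entropy_mixture_le K(1))
      show "finite (set_pmf (q' j))" for j
        by (simp add: q' finP finq)
      show "set_pmf (q' j) \<subseteq> set_pmf r" if "j \<in> {1..K}" for j
        using ac[OF that] unfolding q' r_def by fastforce
    qed simp
    also have "\<dots> = (\<Sum>j\<in>{1..K}. f t s (\<sigma> t j)) / real K"
      by (simp add: rel)
    \<comment> \<open>The selection controls only the sum over \<open>s\<close>; the other terms may
      be added because they are nonnegative.\<close>
    also have "\<dots> \<le> (\<Sum>j\<in>{1..K}. \<Sum>s\<in>{1..S}. f t s (\<sigma> t j)) / real K"
      by (intro divide_right_mono sum_mono member_le_sum[OF s]) (auto intro!: f_nonneg)
    also have "\<dots> \<le> (\<Sum>j\<in>{1..J t}. \<Sum>s\<in>{1..S}. f t s j) / real (J t)"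
      by (rule \<sigma>(3)[OF t])
    also have "\<dots> = (\<Sum>s\<in>{1..S}. leakage m (J t) (V s) (E t))"
      unfolding leakage_eq_rel_entropy[OF J[OF t] E[OF t]] f_def q_def
      by (subst sum.swap) (simp add: sum_divide_distrib)
    finally show "leakage (k + m) K (V s) (E' t) \<le> (\<Sum>s\<in>{1..S}. leakage m (J t) (V s) (E t))" .
  qed
qed

section \<open>Achievable rates\<close>

text \<open>The everywhere \<open>undefined\<close> function is a word of every length, so one
  constant encoder fits all \<open>n\<close>.\<close>

definition zero_rate_encoder :: "nat \<Rightarrow> (nat \<Rightarrow> 'a) pmf" where
  "zero_rate_encoder j = return_pmf (\<lambda>_. undefined)"

lemma encoder_zero_rate: "encoder n J zero_rate_encoder"
  by (simp add: encoder_def zero_rate_encoder_def words_def PiE_iff extensional_def)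

lemma decoding_sets_zero_rate: "decoding_sets n 1 (\<lambda>_. words n)"
  by (simp add: decoding_sets_def disjoint_family_on_def)

lemma error_prob_all_words [simp]: "error_prob n W E (\<lambda>_. words n) j = 0"
  by (simp add: error_prob_def)

lemma leakage_single_message:
  fixes V :: "'a::finite \<Rightarrow> 'c::finite pmf"
  assumes "encoder n 1 E"
  shows "leakage n 1 V E = 0"
proof -
  have "mixture 1 q = q 1" for q :: "nat \<Rightarrow> (nat \<Rightarrow> 'c) pmf"
    by (rule pmf_eqI) (simp add: pmf_mixture)
  then show ?thesis
    unfolding leakage_eq_rel_entropy[OF order_refl assms] by simp
qed

lemma achievable_CSIt_zero:
  fixes W :: "nat \<Rightarrow> 'a::finite \<Rightarrow> 'b::finite pmf" and V :: "nat \<Rightarrow> 'a \<Rightarrow> 'c::finite pmf"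
  assumes "T \<ge> 1" "S \<ge> 1"
  shows "achievable_CSIt T S W V 0"
proof -
  have "leakage n (Suc 0) (V s) zero_rate_encoder = 0" for n s
    using leakage_single_message[OF encoder_zero_rate, of n "V s"] by simp
  then show ?thesis
    unfolding achievable_CSIt_def using assms
    by (intro conjI order_refl exI[of _ "\<lambda>_. 1"] exI[of _ "\<lambda>_ _. zero_rate_encoder"]
          exI[of _ "\<lambda>n _. words n"])
       (auto simp: encoder_zero_rate decoding_sets_def disjoint_family_on_def
          image_constant_conv case_prod_beta intro!: Liminf_bounded)
qed

text \<open>The encoder for \<open>t\<close> with the common decoding sets is a code for
  \<open>W t\<close>. Its maxima range over fewer terms, and nonnegativity squeezes them to
  zero.\<close>

lemma achievable_of_achievable_CSIt:
  fixes W :: "nat \<Rightarrow> 'a::finite \<Rightarrow> 'b::finite pmf" and V :: "nat \<Rightarrow> 'a \<Rightarrow> 'c::finite pmf"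
  assumes "achievable_CSIt T S W V R" and t: "t \<in> {1..T}" and S: "S \<ge> 1"
  shows "achievable S (W t) V R"
proof -
  obtain J E D where R: "0 \<le> R" "ereal R \<le> liminf (\<lambda>n. ereal (1 / real n * log 2 (real (J n))))"
    and code: "\<And>n. n \<ge> 1 \<Longrightarrow> 1 \<le> J n" "\<And>n t. n \<ge> 1 \<Longrightarrow> t \<in> {1..T} \<Longrightarrow> encoder n (J n) (E n t)"
      "\<And>n. n \<ge> 1 \<Longrightarrow> decoding_sets n (J n) (D n)"
    and err: "(\<lambda>n. MAX t\<in>{1..T}. MAX j\<in>{1..J n}. error_prob n (W t) (E n t) (D n) j) \<longlonglongrightarrow> 0"
    and leak: "(\<lambda>n. MAX (t, s)\<in>{1..T} \<times> {1..S}. leakage n (J n) (V s) (E n t)) \<longlonglongrightarrow> 0"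
    using assms(1) unfolding achievable_CSIt_def by blast
  have "(\<lambda>n. MAX j\<in>{1..J n}. error_prob n (W t) (E n t) (D n) j) \<longlonglongrightarrow> 0"
  proof (rule tendsto_sandwich[OF _ _ tendsto_const err])
    show "\<forall>\<^sub>F n in sequentially. 0 \<le> (MAX j\<in>{1..J n}. error_prob n (W t) (E n t) (D n) j)"
      using eventually_ge_at_top[of 1] by eventually_elim (use code(1) in \<open>auto simp: Max_ge_iff error_prob_nonneg\<close>)
    show "\<forall>\<^sub>F n in sequentially. (MAX j\<in>{1..J n}. error_prob n (W t) (E n t) (D n) j)
        \<le> (MAX t\<in>{1..T}. MAX j\<in>{1..J n}. error_prob n (W t) (E n t) (D n) j)"
      using t by (intro always_eventually allI Max_ge) auto
  qed
  moreover have "(\<lambda>n. MAX s\<in>{1..S}. leakage n (J n) (V s) (E n t)) \<longlonglongrightarrow> 0"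
  proof (rule tendsto_sandwich[OF _ _ tendsto_const leak])
    show "\<forall>\<^sub>F n in sequentially. 0 \<le> (MAX s\<in>{1..S}. leakage n (J n) (V s) (E n t))"
      using eventually_ge_at_top[of 1]
      by eventually_elim (use code t S in \<open>auto simp: Max_ge_iff intro!: leakage_nonneg bexI[of _ 1]\<close>)
    show "\<forall>\<^sub>F n in sequentially. (MAX s\<in>{1..S}. leakage n (J n) (V s) (E n t))
        \<le> (MAX (t, s)\<in>{1..T} \<times> {1..S}. leakage n (J n) (V s) (E n t))"
      using t S by (intro always_eventually allI Max_mono) auto
  qed
  ultimately show ?thesis
    unfolding achievable_def using R code t
    by (intro conjI exI[of _ J] exI[of _ "\<lambda>n. E n t"] exI[of _ D]) auto
qed

text \<open>Over a constant channel the error probabilities of two messages sum to at least one.\<close>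

lemma achievable_pos_imp_nonconstant:
  fixes W :: "'a::finite \<Rightarrow> 'b::finite pmf" and V :: "nat \<Rightarrow> 'a \<Rightarrow> 'c::finite pmf"
  assumes "achievable S W V R" "0 < R"
  shows "\<exists>a b. W a \<noteq> W b"
proof (rule ccontr)
  assume "\<not> ?thesis"
  then have const: "memoryless W n x = memoryless W n x'" for n x x'
    unfolding memoryless_def by metis
  obtain J E D where R: "ereal R \<le> liminf (\<lambda>n. ereal (1 / real n * log 2 (real (J n))))"
    and code: "\<And>n. n \<ge> 1 \<Longrightarrow> encoder n (J n) (E n)" "\<And>n. n \<ge> 1 \<Longrightarrow> decoding_sets n (J n) (D n)"
    and err: "(\<lambda>n. MAX j\<in>{1..J n}. error_prob n W (E n) (D n) j) \<longlonglongrightarrow> 0"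
    using assms(1) unfolding achievable_def by blast
  have "ereal 0 < liminf (\<lambda>n. ereal (1 / real n * log 2 (real (J n))))"
    using R assms(2) by (metis ereal_less(2) less_le_trans zero_ereal_def)
  then have "\<forall>\<^sub>F n in sequentially. ereal 0 < ereal (1 / real n * log 2 (real (J n)))"
    by (rule less_LiminfD)
  moreover have "\<forall>\<^sub>F n in sequentially. (MAX j\<in>{1..J n}. error_prob n W (E n) (D n) j) < 1 / 2"
    using order_tendstoD(2)[OF err, of "1/2"] by simp
  ultimately have "\<forall>\<^sub>F n in sequentially. False"
    using eventually_ge_at_top[of 1]
  proof eventually_elim
    case (elim n)
    have "log 2 (real (J n)) > 0"
      using elim by (simp add: zero_less_divide_iff)
    then have J: "1 < J n"
      by (cases "J n \<le> 1") (auto simp: le_Suc_eq log_def)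
    \<comment> \<open>Every input word gives the same output law, so \<open>undefined\<close> is an
      arbitrary representative.\<close>
    let ?M = "memoryless W n undefined"
    have e: "error_prob n W (E n) (D n) j = measure_pmf.prob ?M (words n - D n j)"
      if "j \<in> {1..J n}" for j
    proof -
      have "channel_output W n (E n j) = ?M"
      proof -
        have "channel_output W n (E n j) = bind_pmf (E n j) (\<lambda>_. ?M)"
          unfolding channel_output_def by (intro bind_pmf_cong const refl)
        then show ?thesis
          by simp
      qed
      then show ?thesis
        using code(1)[of n] elim that by (simp add: error_prob_eq encoder_def)
    qed
    have le: "error_prob n W (E n) (D n) j < 1 / 2" if "j \<in> {1..J n}" for j
      using elim(2) that by (subst (asm) Max_less_iff) auto
    have "disjoint_family_on (D n) {1..J n}"
      using code(2)[of n] elim by (simp add: decoding_sets_def)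
    then have "D n 1 \<inter> D n 2 = {}"
      using J by (intro disjoint_family_onD) auto
    then have "words n \<subseteq> (words n - D n 1) \<union> (words n - D n 2)"
      by blast
    then have "measure_pmf.prob ?M (words n) \<le> measure_pmf.prob ?M ((words n - D n 1) \<union> (words n - D n 2))"
      by (intro measure_pmf.finite_measure_mono) auto
    also have "\<dots> \<le> measure_pmf.prob ?M (words n - D n 1) + measure_pmf.prob ?M (words n - D n 2)"
      by (rule measure_Un_le) auto
    also have "\<dots> < 1"
      using le[of 1] le[of 2] e[of 1] e[of 2] J by simp
    also have "measure_pmf.prob ?M (words n) = 1"
      using set_pmf_memoryless[of W n undefined] by (subst measure_pmf.prob_eq_1) (auto simp: AE_measure_pmf_iff)
    finally show False
      by simp
  qed
  then show False
    by simp
qed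


text \<open>
  The state announcement occupies only about \<open>sqrt n\<close> of the \<open>n\<close> channel uses, so it costs
  no rate.
\<close>

lemma achievable_CSIt_direct:
  fixes W :: "nat \<Rightarrow> 'a::finite \<Rightarrow> 'b::finite pmf" and V :: "nat \<Rightarrow> 'a \<Rightarrow> 'c::finite pmf"
  assumes T: "T \<ge> 1" and S: "S \<ge> 1" and R: "0 \<le> R"
    and ach: "\<And>t. t \<in> {1..T} \<Longrightarrow> \<exists>R'>R. achievable S (W t) V R'"
  shows "achievable_CSIt T S W V R"
proof -
  define codes where "codes t J E D r \<longleftrightarrow> R < r \<and>
        (\<forall>n\<ge>1. 1 \<le> J n \<and> encoder n (J n) (E n) \<and> decoding_sets n (J n) (D n)) \<and>
        (\<lambda>n. MAX j\<in>{1..J n}. error_prob n (W t) (E n) (D n) j) \<longlonglongrightarrow> 0 \<and>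
        ereal r \<le> liminf (\<lambda>n. ereal (1 / real n * log 2 (real (J n)))) \<and>
        (\<lambda>n. MAX s\<in>{1..S}. leakage n (J n) (V s) (E n)) \<longlonglongrightarrow> 0"
    for t J E D r
  have "\<exists>J E D r. codes t J E D r" if "t \<in> {1..T}" for t
    using ach[OF that] unfolding achievable_def codes_def by blast
  then obtain J E D R' where codes: "\<And>t. t \<in> {1..T} \<Longrightarrow> codes t (J t) (E t) (D t) (R' t)"
    by metis
  have R': "R < R' t"
    and code: "\<And>n. n \<ge> 1 \<Longrightarrow> 1 \<le> J t n \<and> encoder n (J t n) (E t n) \<and> decoding_sets n (J t n) (D t n)"
    and err_lim: "(\<lambda>n. MAX j\<in>{1..J t n}. error_prob n (W t) (E t n) (D t n) j) \<longlonglongrightarrow> 0"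
    and rate: "ereal (R' t) \<le> liminf (\<lambda>n. ereal (1 / real n * log 2 (real (J t n))))"
    and leak_lim: "(\<lambda>n. MAX s\<in>{1..S}. leakage n (J t n) (V s) (E t n)) \<longlonglongrightarrow> 0"
    if "t \<in> {1..T}" for t
    using codes[OF that] unfolding codes_def by simp_all
  \<comment> \<open>Each \<open>R'\<close> exceeds \<open>R \<ge> 0\<close>, hence is positive,
    which excludes a constant channel.\<close>
  have nonconst: "\<exists>a b. W t a \<noteq> W t b" if "t \<in> {1..T}" for t
    using ach[OF that] R achievable_pos_imp_nonconstant by (meson le_less_trans)
  obtain u :: "nat \<Rightarrow> nat \<Rightarrow> nat \<Rightarrow> 'a" and G :: "nat \<Rightarrow> nat \<Rightarrow> (nat \<Rightarrow> 'b) set" and err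
    where u: "\<And>m t. u m t \<in> words (m * (T + 1))" and G: "\<And>m t. G m t \<subseteq> words (m * (T + 1))"
      "\<And>m. disjoint_family_on (G m) {1..T}" and err: "err \<longlonglongrightarrow> 0"
      "\<And>m t. t \<in> {1..T} \<Longrightarrow> measure_pmf.prob (memoryless (W t) (m * (T + 1)) (u m t))
         (words (m * (T + 1)) - G m t) \<le> err m"
    by (rule state_announcement[of T W]) (use nonconst in blast)+
  \<comment> \<open>The block length must tend to infinity, to make the announcement reliable, yet
    be \<open>o(n)\<close>, to cost no rate.\<close>
  define m where "m n = nat \<lfloor>sqrt (real n)\<rfloor>" for n
  define k where "k n = m n * (T + 1)" for n
  define l where "l n = n - k n" for n
  \<comment> \<open>Rounding up keeps the rate at least \<open>R\<close>; the slack between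
    \<open>R\<close> and \<open>R' t\<close> pays for the shortened inner code.\<close>
  define K where "K n = nat \<lceil>2 powr (real n * R)\<rceil>" for n
  define perr where "perr t n = (MAX j\<in>{1..J t n}. error_prob n (W t) (E t n) (D t n) j)" for t n
  define pleak where "pleak t n = (\<Sum>s\<in>{1..S}. leakage n (J t n) (V s) (E t n))" for t n
  have m_top: "filterlim m at_top sequentially"
    unfolding m_def by real_asymp
  have k_le: "real (k n) \<le> real (T + 1) * sqrt (real n)" for n
  proof -
    have "real (m n) \<le> sqrt (real n)"
      by (simp add: m_def)
    then have "real (T + 1) * real (m n) \<le> real (T + 1) * sqrt (real n)"
      by (intro mult_left_mono) simp_all
    also have "real (T + 1) * real (m n) = real (k n)"
      by (simp only: k_def of_nat_mult mult.commute)
    finally show ?thesis .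
  qed
  have k_small: "\<forall>\<^sub>F n in sequentially. real (k n) \<le> c * real n" if "c > 0" for c
  proof -
    have "\<forall>\<^sub>F n in sequentially. real (T + 1) * sqrt (real n) \<le> c * real n"
      using that by real_asymp
    then show ?thesis
      by eventually_elim (use k_le order_trans in blast)
  qed
  have l_top: "filterlim l at_top sequentially"
    unfolding filterlim_at_top
  proof
    fix Z :: nat
    have "\<forall>\<^sub>F n in sequentially. real (k n) \<le> 1 / 2 * real n"
      by (rule k_small) simp
    then show "\<forall>\<^sub>F n in sequentially. Z \<le> l n"
      using eventually_ge_at_top[of "2 * Z"]
    proof eventually_elim
      case (elim n)
      then have "2 * k n \<le> n"
        by linarith
      then show ?case
        using elim(2) by (simp add: l_def)
    qed
  qed
  have K_le: "\<forall>\<^sub>F n in sequentially. K n \<le> J t (l n)" if t: "t \<in> {1..T}" for t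
  proof -
    \<comment> \<open>Being below \<open>R' t\<close>, the rate \<open>c\<close> is eventually
      exceeded by the code for \<open>t\<close>; being above \<open>R\<close>, it leaves room for
      the prefix.\<close>
    define c where "c = (R + R' t) / 2"
    have c: "R < c" "c < R' t" "0 < c"
      using R'[OF t] R by (auto simp: c_def)
    then have "ereal c < liminf (\<lambda>n. ereal (1 / real n * log 2 (real (J t n))))"
      using rate[OF t] by (metis ereal_less_eq(3) less_ereal.simps(1) order_less_le_trans)
    then have "\<forall>\<^sub>F n in sequentially. ereal c < ereal (1 / real n * log 2 (real (J t n)))"
      by (rule less_LiminfD)
    then have "\<forall>\<^sub>F n in sequentially. ereal c < ereal (1 / real (l n) * log 2 (real (J t (l n))))"
      by (rule eventually_compose_filterlim[OF _ l_top])
    moreover have "\<forall>\<^sub>F n in sequentially. 1 \<le> l n"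
      using l_top by (simp add: filterlim_at_top)
    \<comment> \<open>With \<open>l n = n - k n\<close>, this fraction is exactly what gives
      \<open>real n * R \<le> real (l n) * c\<close>.\<close>
    moreover have "\<forall>\<^sub>F n in sequentially. real (k n) \<le> (c - R) / c * real n"
      using c by (intro k_small) auto
    ultimately show ?thesis
    proof eventually_elim
      case (elim n)
      have J: "1 \<le> J t (l n)"
        using code[OF t elim(2)] by simp
      \<comment> \<open>Natural subtraction truncates; \<open>1 \<le> l n\<close> guarantees
        \<open>k n < n\<close>.\<close>
      have ln: "real (l n) = real n - real (k n)"
        using elim(2) by (simp add: l_def)
      have "real (k n) * c \<le> (c - R) * real n"
        using elim(3) c by (simp add: field_simps)
      then have "real n * R \<le> real (l n) * c"
        by (simp add: ln algebra_simps)
      also have "\<dots> \<le> log 2 (real (J t (l n)))"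
        using elim(1,2) by (simp add: field_simps)
      finally have "2 powr (real n * R) \<le> real (J t (l n))"
        using J by (simp add: le_log_iff)
      then show ?case
        by (simp add: K_def nat_le_iff ceiling_le_iff)
    qed
  qed
  define ok where "ok n \<longleftrightarrow> k n \<le> n \<and> 1 \<le> l n \<and> (\<forall>t\<in>{1..T}. K n \<le> J t (l n))" for n
  have ev_ok: "\<forall>\<^sub>F n in sequentially. ok n"
  proof -
    have "\<forall>\<^sub>F n in sequentially. \<forall>t\<in>{1..T}. K n \<le> J t (l n)"
      using K_le by (simp add: eventually_ball_finite_distrib)
    moreover have "\<forall>\<^sub>F n in sequentially. 1 \<le> l n"
      using l_top by (simp add: filterlim_at_top)
    ultimately show ?thesis
      by eventually_elim (simp add: ok_def l_def)
  qed
  have K_pos: "1 \<le> K n" for n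
    by (simp add: K_def Suc_le_eq)
  define combined where "combined n e d \<longleftrightarrow>
      (\<forall>t\<in>{1..T}. encoder n (K n) (e t)) \<and> decoding_sets n (K n) d \<and>
      (\<forall>t\<in>{1..T}. \<forall>j\<in>{1..K n}. error_prob n (W t) (e t) d j \<le> err (m n) + perr t (l n)) \<and>
      (\<forall>t\<in>{1..T}. \<forall>s\<in>{1..S}. leakage n (K n) (V s) (e t) \<le> pleak t (l n))"
    for n and e :: "nat \<Rightarrow> nat \<Rightarrow> (nat \<Rightarrow> 'a) pmf" and d :: "nat \<Rightarrow> (nat \<Rightarrow> 'b) set"
  have "\<exists>e d. combined n e d" if "ok n" for n
  proof -
    have n: "k n + l n = n" "1 \<le> l n" and Kn: "\<And>t. t \<in> {1..T} \<Longrightarrow> K n \<le> J t (l n)"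
      using that by (auto simp: ok_def l_def)
    have G': "disjoint_family_on (G (m n)) {1..T}" "\<And>t. G (m n) t \<subseteq> words (k n)"
      "\<And>t. u (m n) t \<in> words (k n)"
      unfolding k_def using G u by auto
    have enc: "\<And>t. t \<in> {1..T} \<Longrightarrow> encoder (l n) (J t (l n)) (E t (l n))"
      and dec: "\<And>t. t \<in> {1..T} \<Longrightarrow> decoding_sets (l n) (J t (l n)) (D t (l n))"
      using code n(2) by auto
    obtain e d where ed: "\<And>t. t \<in> {1..T} \<Longrightarrow> encoder (k n + l n) (K n) (e t)"
      "decoding_sets (k n + l n) (K n) d"
      "\<And>t j. t \<in> {1..T} \<Longrightarrow> j \<in> {1..K n} \<Longrightarrow> error_prob (k n + l n) (W t) (e t) d j
        \<le> measure_pmf.prob (memoryless (W t) (k n) (u (m n) t)) (words (k n) - G (m n) t)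
          + (MAX i\<in>{1..J t (l n)}. error_prob (l n) (W t) (E t (l n)) (D t (l n)) i)"
      "\<And>t s. t \<in> {1..T} \<Longrightarrow> s \<in> {1..S} \<Longrightarrow> leakage (k n + l n) (K n) (V s) (e t)
        \<le> (\<Sum>s\<in>{1..S}. leakage (l n) (J t (l n)) (V s) (E t (l n)))"
      by (rule combine_codes[where u = "u (m n)" and J = "\<lambda>t. J t (l n)" and E = "\<lambda>t. E t (l n)"
            and D = "\<lambda>t. D t (l n)" and W = W and V = V and S = S, OF G'(3,1,2) K_pos Kn enc dec])
         (assumption | rule that)+
    have "error_prob n (W t) (e t) d j \<le> err (m n) + perr t (l n)" if "t \<in> {1..T}" "j \<in> {1..K n}" for t j
      using ed(3)[OF that] err(2)[OF that(1), of "m n"]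
      unfolding n(1) perr_def k_def[symmetric] by linarith
    moreover have "leakage n (K n) (V s) (e t) \<le> pleak t (l n)" if "t \<in> {1..T}" "s \<in> {1..S}" for t s
      using ed(4)[OF that] by (simp add: n(1) pleak_def)
    ultimately have "combined n e d"
      using ed(1,2) by (simp add: combined_def n(1))
    then show ?thesis
      by blast
  qed
  then obtain e d where ed: "\<And>n. ok n \<Longrightarrow> combined n (e n) (d n)"
    by metis
  \<comment> \<open>A code is demanded at every \<open>n \<ge> 1\<close>; the finitely many lengths
    that are not \<open>ok\<close> get a single message, without effect on the limits.\<close>
  define J' where "J' n = (if ok n then K n else 1)" for n
  define E' where "E' n t = (if ok n then e n t else zero_rate_encoder)" for n t
  define D' where "D' n = (if ok n then d n else (\<lambda>_. words n))" for n
  have code': "1 \<le> J' n \<and> (\<forall>t\<in>{1..T}. encoder n (J' n) (E' n t)) \<and> decoding_sets n (J' n) (D' n)" for n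
    using ed[of n] K_pos[of n] encoder_zero_rate decoding_sets_zero_rate
    by (auto simp: J'_def E'_def D'_def combined_def)
  have perr_nonneg: "0 \<le> perr t n" if "t \<in> {1..T}" "1 \<le> n" for t n
    using code[OF that] unfolding perr_def by (auto simp: Max_ge_iff error_prob_nonneg)
  have leak_nonneg: "0 \<le> leakage n (J t n) (V s) (E t n)" if "t \<in> {1..T}" "1 \<le> n" for t n s
    using code[OF that] by (intro leakage_nonneg) auto
  have pleak_lim: "pleak t \<longlonglongrightarrow> 0" if t: "t \<in> {1..T}" for t
    unfolding pleak_def
  proof (rule tendsto_null_sum)
    fix s assume s: "s \<in> {1..S}"
    show "(\<lambda>n. leakage n (J t n) (V s) (E t n)) \<longlonglongrightarrow> 0"
    proof (rule tendsto_sandwich[OF _ _ tendsto_const leak_lim[OF t]])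
      show "\<forall>\<^sub>F n in sequentially. 0 \<le> leakage n (J t n) (V s) (E t n)"
        using eventually_ge_at_top[of 1] by eventually_elim (rule leak_nonneg[OF t])
      show "\<forall>\<^sub>F n in sequentially. leakage n (J t n) (V s) (E t n)
          \<le> (MAX s\<in>{1..S}. leakage n (J t n) (V s) (E t n))"
        using s by (intro always_eventually allI Max_ge) auto
    qed
  qed
  have "(\<lambda>n. MAX t\<in>{1..T}. MAX j\<in>{1..J' n}. error_prob n (W t) (E' n t) (D' n) j) \<longlonglongrightarrow> 0"
  proof (rule tendsto_sandwich[OF _ _ tendsto_const])
    show "\<forall>\<^sub>F n in sequentially. 0 \<le> (MAX t\<in>{1..T}. MAX j\<in>{1..J' n}. error_prob n (W t) (E' n t) (D' n) j)"
    proof (intro always_eventually allI)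
      fix n
      have "0 \<le> error_prob n (W 1) (E' n 1) (D' n) 1"
        by (rule error_prob_nonneg)
      also have "\<dots> \<le> (MAX j\<in>{1..J' n}. error_prob n (W 1) (E' n 1) (D' n) j)"
        using code'[of n] by (intro Max_ge) auto
      also have "\<dots> \<le> (MAX t\<in>{1..T}. MAX j\<in>{1..J' n}. error_prob n (W t) (E' n t) (D' n) j)"
        using T by (intro Max_ge) auto
      finally show "0 \<le> (MAX t\<in>{1..T}. MAX j\<in>{1..J' n}. error_prob n (W t) (E' n t) (D' n) j)" .
    qed
    show "\<forall>\<^sub>F n in sequentially. (MAX t\<in>{1..T}. MAX j\<in>{1..J' n}. error_prob n (W t) (E' n t) (D' n) j)
        \<le> err (m n) + (\<Sum>t\<in>{1..T}. perr t (l n))"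
      using ev_ok
    proof eventually_elim
      case (elim n)
      have "error_prob n (W t) (E' n t) (D' n) j \<le> err (m n) + (\<Sum>t\<in>{1..T}. perr t (l n))"
        if t: "t \<in> {1..T}" and j: "j \<in> {1..J' n}" for t j
      proof -
        have "error_prob n (W t) (E' n t) (D' n) j \<le> err (m n) + perr t (l n)"
          using ed[OF elim] elim t j by (simp add: combined_def J'_def E'_def D'_def)
        also have "perr t (l n) \<le> (\<Sum>t\<in>{1..T}. perr t (l n))"
          using elim by (intro member_le_sum[OF t] perr_nonneg) (auto simp: ok_def)
        finally show ?thesis
          by simp
      qed
      then show ?case
        using T code'[of n] by (auto simp: Max_le_iff)
    qed
    have "(\<lambda>n. err (m n) + (\<Sum>t\<in>{1..T}. perr t (l n))) \<longlonglongrightarrow> 0 + (\<Sum>t\<in>{1..T}. 0)"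
      using err_lim unfolding perr_def[symmetric]
      by (intro tendsto_add tendsto_sum filterlim_compose[OF err(1) m_top] filterlim_compose[OF _ l_top])
    then show "(\<lambda>n. err (m n) + (\<Sum>t\<in>{1..T}. perr t (l n))) \<longlonglongrightarrow> 0"
      by simp
  qed
  moreover have "(\<lambda>n. MAX (t, s)\<in>{1..T} \<times> {1..S}. leakage n (J' n) (V s) (E' n t)) \<longlonglongrightarrow> 0"
  proof (rule tendsto_sandwich[OF _ _ tendsto_const])
    show "\<forall>\<^sub>F n in sequentially. 0 \<le> (MAX (t, s)\<in>{1..T} \<times> {1..S}. leakage n (J' n) (V s) (E' n t))"
    proof (intro always_eventually allI)
      fix n
      have "0 \<le> leakage n (J' n) (V 1) (E' n 1)"
        using code'[of n] T by (intro leakage_nonneg) auto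
      also have "\<dots> \<le> (MAX (t, s)\<in>{1..T} \<times> {1..S}. leakage n (J' n) (V s) (E' n t))"
        using T S by (intro Max_ge) force+
      finally show "0 \<le> (MAX (t, s)\<in>{1..T} \<times> {1..S}. leakage n (J' n) (V s) (E' n t))" .
    qed
    show "\<forall>\<^sub>F n in sequentially. (MAX (t, s)\<in>{1..T} \<times> {1..S}. leakage n (J' n) (V s) (E' n t))
        \<le> (\<Sum>t\<in>{1..T}. pleak t (l n))"
      using ev_ok
    proof eventually_elim
      case (elim n)
      have "leakage n (J' n) (V s) (E' n t) \<le> (\<Sum>t\<in>{1..T}. pleak t (l n))"
        if t: "t \<in> {1..T}" and s: "s \<in> {1..S}" for t s
      proof -
        have "leakage n (J' n) (V s) (E' n t) \<le> pleak t (l n)"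
          using ed[OF elim] elim t s by (simp add: combined_def J'_def E'_def)
        also have "\<dots> \<le> (\<Sum>t\<in>{1..T}. pleak t (l n))"
          using elim unfolding pleak_def
          by (intro member_le_sum[OF t] sum_nonneg leak_nonneg) (auto simp: ok_def)
        finally show ?thesis .
      qed
      then show ?case
        using T S by (auto simp: Max_le_iff)
    qed
    have "(\<lambda>n. \<Sum>t\<in>{1..T}. pleak t (l n)) \<longlonglongrightarrow> (\<Sum>t\<in>{1..T}. 0)"
      by (intro tendsto_sum filterlim_compose[OF pleak_lim l_top])
    then show "(\<lambda>n. \<Sum>t\<in>{1..T}. pleak t (l n)) \<longlonglongrightarrow> 0"
      by simp
  qed
  moreover have "ereal R \<le> liminf (\<lambda>n. ereal (1 / real n * log 2 (real (J' n))))"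
  proof (rule Liminf_bounded)
    show "\<forall>\<^sub>F n in sequentially. ereal R \<le> ereal (1 / real n * log 2 (real (J' n)))"
      using ev_ok eventually_gt_at_top[of 0]
    proof eventually_elim
      case (elim n)
      have "2 powr (real n * R) \<le> real (K n)"
        unfolding K_def by (rule real_nat_ceiling_ge)
      then have "real n * R \<le> log 2 (real (J' n))"
        using elim(1) K_pos[of n] by (simp add: le_log_iff J'_def)
      then show ?case
        using elim(2) by (simp add: field_simps)
    qed
  qed
  ultimately show ?thesis
    unfolding achievable_CSIt_def using R code' by blast
qed

section \<open>Equality of the capacity with state information and the infimum\<close>

theorem proposition3p12:
  fixes W :: "nat \<Rightarrow> 'a::finite \<Rightarrow> 'b::finite pmf"
    and V :: "nat \<Rightarrow> 'a \<Rightarrow> 'c::finite pmf"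
    and T S :: nat
  assumes "T \<ge> 1" and "S \<ge> 1"
  shows "secrecy_capacity_CSIt T S W V = (INF t\<in>{1..T}. secrecy_capacity S (W t) V)"
proof (rule antisym)
  show "secrecy_capacity_CSIt T S W V \<le> (INF t\<in>{1..T}. secrecy_capacity S (W t) V)"
    unfolding secrecy_capacity_CSIt_def secrecy_capacity_def using assms
    by (intro INF_greatest SUP_subset_mono order_refl)
       (auto intro: achievable_of_achievable_CSIt)
  show "(INF t\<in>{1..T}. secrecy_capacity S (W t) V) \<le> secrecy_capacity_CSIt T S W V"
  \<comment> \<open>Working strictly below the infimum supplies, for each \<open>t\<close>, an
    achievable rate exceeding the target.\<close>
  proof (rule dense_le)
    fix x assume x: "x < (INF t\<in>{1..T}. secrecy_capacity S (W t) V)"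
    show "x \<le> secrecy_capacity_CSIt T S W V"
    \<comment> \<open>If the infimum is zero, only negative \<open>x\<close> occur, and rate zero
      suffices without announcing the state, which may then be impossible.\<close>
    proof (cases "x < 0")
      case True
      then show ?thesis
        unfolding secrecy_capacity_CSIt_def using achievable_CSIt_zero[OF assms]
        by (intro SUP_upper2[of 0]) (auto simp: less_imp_le zero_ereal_def)
    next
      case False
      then obtain R where R: "x = ereal R" "0 \<le> R"
        using x by (cases x) auto
      have "\<exists>R'>R. achievable S (W t) V R'" if "t \<in> {1..T}" for t
      proof -
        have "ereal R < secrecy_capacity S (W t) V"
          using x that unfolding R by (rule less_INF_D)
        then show ?thesis
          unfolding secrecy_capacity_def by (auto simp: less_SUP_iff)
      qed
      then have "achievable_CSIt T S W V R"
        using achievable_CSIt_direct[OF assms R(2)] by blast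
      then show ?thesis
        unfolding secrecy_capacity_CSIt_def R by (intro SUP_upper) simp
    qed
  qed
qed

end
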